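(* Let $(X,d)$ be a metric space and let $\mu$ be a Borel measure on $X$ such that $0<\mu(B)<\infty$ for every $d$-ball $B\subset X$. Let $\Phi:[0,\infty)\to[0,\infty)$ be a Young function, and let $\varphi$ be a nondecreasing function of $r>0$ with $\varphi(r)\ge r$. Suppose that $(X,d,\mu)$ admits a weak Orlicz-Sobolev inequality with superradius $\varphi$ and finite constant $C_S>0$, i.e. for every $d$-ball $B=B_d(y,r)\subset X$, every $w\in N_0^{1,1}(B)$ with $\operatorname{supp} w\subset B$, and every upper gradient $g$ of $w$, $$\|w\|_{L^{\Phi}(\mu_B)}\le C_S\,\varphi(r(B))\,\|g\|_{L^1(\mu_B)}.$$ Assume also that for some $\alpha>1$, $$\Phi(t)\ge t(\ln t)^{\alpha}\quad\text{for all } t>1.$$ Then for every $\varepsilon>0$ the superradius $\varphi$ satisfies, for every $d$-ball $B$ with radius $r(B)$, $$\frac{\varphi(r(B))}{r(B)}\ge C_\varepsilon\left(\ln\left[\frac{\mu(B)}{\mu\left(\frac12 B\right)}\right]\right)^{\alpha-1-\varepsilon},$$ where the constant $C_\varepsilon>0$ depends on $\varepsilon$, $\alpha$ and $C_S$. In particular, if $\varphi(r)=r$, the measure $\mu$ is doubling on $(X,d)$, i.e. there is a constant $C_D\ge1$ such that $\mu(B_d(y,2r))\le C_D\,\mu(B_d(y,r))$ for all $y\in X$ and $r>0$.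
   Context: For $y\in X$ and $r>0$, the $d$-ball is $B_d(y,r)=\{x\in X: d(x,y)<r\}$; a ball is regarded as coming with its center and radius $r=r(B)$, and $\frac12B:=B_d(y,r/2)$ for $B=B_d(y,r)$. For a ball $B$, $d\mu_B:=d\mu/\mu(B)$, and norms over $\mu_B$ are taken on $B$. Upper gradient: given $u:X\to[-\infty,\infty]$, a non-negative Borel function $g:X\to[0,\infty]$ is an upper gradient of $u$ if for all curves (non-constant rectifiable continuous mappings) $\gamma:[0,l_\gamma]\to X$ one has $|u(\gamma(0))-u(\gamma(l_\gamma))|\le\int_\gamma g\,ds$. Newtonian space: for $1\le p<\infty$ and $u\in L^p(X,\mu)$ set $\|u\|_{N^{1,p}}^p:=\int_X|u|^p\,d\mu+\inf_g\int_X g^p\,d\mu$, where the infimum is over all upper gradients $g$ of $u$. For a $d$-ball $B\subset X$, $N_0^{1,p}(B):=\{f|_B:\ \|f\|_{N^{1,p}}<\infty \text{ and } f\equiv 0 \text{ on } X\setminus B\}$. An element $w$ of $N_0^{1,p}(B)$ is identified with its extension by zero to $X$, and upper gradients of $w$ are those of this extension. Young function: here, a convex piecewise differentiable function $\Phi:[0,\infty)\to[0,\infty)$ (there are at most finitely many points where the derivative may fail to exist, but one-sided derivatives exist everywhere) such that $\Phi(0)=0$, $\Phi(x)/x\to\infty$ as $x\to\infty$, and $\Phi(x)/x\to0$ as $x\to0$. Orlicz norm: for a $\sigma$-finite measure $\nu$, $\|f\|_{L^\Phi(\nu)}:=\inf\{k\in(0,\infty):\int\Phi(|f|/k)\,d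\nu\le1\}$.
   Formalization: Proved for 0<ε≤α; for ε>α it is false (X=ℝ, dμ=(1+|x|)^{-2}dx, φ(r)=r(1+r), Φ(t)=At², B=B(0,r), r→∞). C_ε serves all spaces on subsets of one fixed set; taking ℝ covers every such X up to isometry, as X is separable. *)

theory Defs
  imports "HOL-Analysis.Analysis"
begin

text \<open>
  One-sided derivatives are required at every point of \<open>[0,\<infinity>)\<close>; at the endpoint \<open>0\<close>
  only the right one makes sense, and there differentiability is relative to \<open>[0,\<infinity>)\<close>.
  Only the values of \<open>\<Phi>\<close> on \<open>[0,\<infinity>)\<close> matter.
\<close>

definition young_function :: "(real \<Rightarrow> real) \<Rightarrow> bool" where
  "young_function \<Phi> \<longleftrightarrow>
     convex_on {0..} \<Phi> \<and> (\<forall>x\<ge>0. 0 \<le> \<Phi> x) \<and> \<Phi> 0 = 0 \<and>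
     (\<exists>D. finite D \<and> (\<forall>x\<in>{0..} - D. \<Phi> differentiable (at x within {0..}))) \<and>
     (\<forall>x\<ge>0. \<exists>D. (\<Phi> has_real_derivative D) (at_right x)) \<and>
     (\<forall>x>0. \<exists>D. (\<Phi> has_real_derivative D) (at_left x)) \<and>
     filterlim (\<lambda>x. \<Phi> x / x) at_top at_top \<and>
     ((\<lambda>x. \<Phi> x / x) \<longlongrightarrow> 0) (at_right 0)"

text \<open>A Young function is extended by \<open>\<Phi>(\<infinity>) = \<infinity>\<close>.\<close>

definition young_ext :: "(real \<Rightarrow> real) \<Rightarrow> ennreal \<Rightarrow> ennreal" where
  "young_ext \<Phi> t = (if t = top then top else ennreal (\<Phi> (enn2real t)))"

text \<open>The infimum of the empty set is \<open>\<infinity>\<close>.\<close>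

definition orlicz_norm :: "(real \<Rightarrow> real) \<Rightarrow> 'a measure \<Rightarrow> ('a \<Rightarrow> ereal) \<Rightarrow> ennreal" where
  "orlicz_norm \<Phi> \<nu> f =
     (INF k \<in> {k::real. 0 < k \<and> (\<integral>\<^sup>+x. young_ext \<Phi> (e2ennreal \<bar>f x\<bar> / ennreal k) \<partial>\<nu>) \<le> 1}.
        ennreal k)"

context Metric_space
begin

definition metric_borel :: "'a measure" where
  "metric_borel = sigma M {U. openin mtopology U}"

text \<open>Length of \<open>\<gamma>\<close> on \<open>[a,b]\<close>: the supremum over all partitions \<open>a = t 0 \<le> \<dots> \<le> t n = b\<close>.\<close>

definition curve_length :: "(real \<Rightarrow> 'a) \<Rightarrow> real \<Rightarrow> real \<Rightarrow> ennreal" where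
  "curve_length \<gamma> a b =
     (SUP (n, t) \<in> {(n::nat, t::nat \<Rightarrow> real). t 0 = a \<and> t n = b \<and> mono_on {..n} t}.
        \<Sum>i<n. ennreal (d (\<gamma> (t i)) (\<gamma> (t (Suc i)))))"

definition curve :: "(real \<Rightarrow> 'a) \<Rightarrow> real \<Rightarrow> bool" where
  "curve \<gamma> l \<longleftrightarrow>
     0 < l \<and> continuous_map (top_of_set {0..l}) mtopology \<gamma> \<and> curve_length \<gamma> 0 l < top \<and>
     (\<exists>s\<in>{0..l}. \<exists>t\<in>{0..l}. \<gamma> s \<noteq> \<gamma> t)"

text \<open>
  The arc-length parametrization of a curve \<open>\<gamma>\<close> on \<open>[0,l]\<close> sends \<open>s\<close> to \<open>\<gamma> t\<close> for any \<open>t\<close> such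
  that \<open>\<gamma>\<close> has length \<open>s\<close> on \<open>[0,t]\<close>. The choice of \<open>t\<close> is immaterial, since \<open>\<gamma>\<close> is constant
  on intervals on which it has length \<open>0\<close>. Line integrals are taken with respect to arc length;
  \<open>\<gamma>\<close> itself need not be parametrized by it.
\<close>

definition arc_length_param :: "(real \<Rightarrow> 'a) \<Rightarrow> real \<Rightarrow> real \<Rightarrow> 'a" where
  "arc_length_param \<gamma> l s = \<gamma> (SOME t. t \<in> {0..l} \<and> curve_length \<gamma> 0 t = ennreal s)"

definition line_integral :: "('a \<Rightarrow> ennreal) \<Rightarrow> (real \<Rightarrow> 'a) \<Rightarrow> real \<Rightarrow> ennreal" where
  "line_integral g \<gamma> l =
     (\<integral>\<^sup>+ s \<in> {0..enn2real (curve_length \<gamma> 0 l)}. g (arc_length_param \<gamma> l s) \<partial>lborel)"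

text \<open>
  In \<^typ>\<open>ereal\<close>, \<open>\<bar>a - b\<bar> = \<infinity>\<close> as soon as \<open>a\<close> or \<open>b\<close> is infinite, also if \<open>a = b\<close>. This is the
  usual convention for upper gradients of extended real-valued functions.
\<close>

definition upper_gradient :: "('a \<Rightarrow> ereal) \<Rightarrow> ('a \<Rightarrow> ennreal) \<Rightarrow> bool" where
  "upper_gradient u g \<longleftrightarrow>
     g \<in> borel_measurable metric_borel \<and>
     (\<forall>\<gamma> l. curve \<gamma> l \<longrightarrow> \<bar>u (\<gamma> 0) - u (\<gamma> l)\<bar> \<le> enn2ereal (line_integral g \<gamma> l))"

definition newtonian_norm :: "'a measure \<Rightarrow> ('a \<Rightarrow> ereal) \<Rightarrow> ennreal" where
  "newtonian_norm \<mu> u =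
     (\<integral>\<^sup>+x. e2ennreal \<bar>u x\<bar> \<partial>\<mu>) + (INF g \<in> {g. upper_gradient u g}. \<integral>\<^sup>+x. g x \<partial>\<mu>)"

text \<open>
  The space \<open>N\<^sub>0\<^sup>1\<^sup>,\<^sup>1(B)\<close> (exponent \<open>p = 1\<close>); its elements are represented by their extensions
  by zero to the whole space.
\<close>

definition newtonian_zero :: "'a measure \<Rightarrow> 'a set \<Rightarrow> ('a \<Rightarrow> ereal) set" where
  "newtonian_zero \<mu> B =
     {w. w \<in> borel_measurable \<mu> \<and> newtonian_norm \<mu> w < top \<and> (\<forall>x\<in>M - B. w x = 0)}"

definition support :: "('a \<Rightarrow> ereal) \<Rightarrow> 'a set" where
  "support w = mtopology closure_of {x\<in>M. w x \<noteq> 0}"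

definition weak_orlicz_sobolev ::
    "'a measure \<Rightarrow> (real \<Rightarrow> real) \<Rightarrow> (real \<Rightarrow> real) \<Rightarrow> real \<Rightarrow> bool" where
  "weak_orlicz_sobolev \<mu> \<Phi> \<phi> C \<longleftrightarrow>
     (\<forall>y\<in>M. \<forall>r>0. \<forall>w g.
        w \<in> newtonian_zero \<mu> (mball y r) \<and> support w \<subseteq> mball y r \<and> upper_gradient w g \<longrightarrow>
        orlicz_norm \<Phi> (uniform_measure \<mu> (mball y r)) w
          \<le> ennreal (C * \<phi> r) * (\<integral>\<^sup>+x. g x \<partial>uniform_measure \<mu> (mball y r)))"

definition doubling :: "'a measure \<Rightarrow> bool" where
  "doubling \<mu> \<longleftrightarrow>
     (\<exists>C\<ge>1. \<forall>y\<in>M. \<forall>r>0. measure \<mu> (mball y (2 * r)) \<le> C * measure \<mu> (mball y r))"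

end

end

theory Submission
  imports Defs
begin

text \<open>
  Testing the inequality on a fixed ball \<open>B(y,r)\<close> with a cutoff that is \<open>1\<close> on \<open>B(y,p)\<close>,
  vanishes outside \<open>B(y,q)\<close> and has as upper gradient a multiple of the indicator of a closed
  annulus between them, and inverting \<open>\<Phi>(t) \<ge> t (ln t)\<^sup>\<alpha>\<close>, gives
  \<open>\<mu>(B\<^sub>p) L(p)\<^sup>\<alpha> \<le> A \<phi>(r) / (q - p) \<mu>(B\<^sub>q)\<close> with \<open>L(s) = ln (\<mu>(B\<^sub>r) / \<mu>(B\<^sub>s))\<close>. Hence
  shrinking the radius by a multiple of \<open>\<phi>(r) / L\<^sup>\<alpha>\<close> increases \<open>L\<close> by at least \<open>1\<close>. Starting
  at radius \<open>r/2\<close>, the total decrease is of order \<open>\<phi>(r) L(r/2)\<^bsup>1-\<alpha>\<^esup>\<close>, and it must exceed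
  \<open>r/4\<close> because \<open>\<mu>(B\<^bsub>r/4\<^esub>) > 0\<close>. So the bound holds even without the loss \<open>\<epsilon>\<close>; the loss only
  brings in negative exponents \<open>\<alpha> - 1 - \<epsilon> \<ge> -1\<close>, for which small \<open>L(r/2)\<close> need a separate
  estimate: there the gradient of the cutoff is small because the annulus has little measure.
\<close>

subsection \<open>The length function of a curve\<close>

lemma ennreal_le_diffI:
  assumes "a + b \<le> c" "c < (top :: ennreal)"
  shows "b \<le> c - a"
  using assms by (cases a; cases b; cases c) (auto simp: ennreal_minus ennreal_le_iff2 top_unique simp flip: ennreal_plus)

lemma ennreal_le_of_diff_le:
  assumes "c \<le> a + (c - b)" "b \<le> c" "c < (top :: ennreal)"
  shows "b \<le> a"
  using assms by (cases a; cases b; cases c) (auto simp: ennreal_minus ennreal_le_iff2 top_unique simp flip: ennreal_plus)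

context Metric_space
begin

lemma partition_le_curve_length:
  assumes "t 0 = a" "t n = b" "mono_on {..n} t"
  shows "(\<Sum>i<n. ennreal (d (\<gamma> (t i)) (\<gamma> (t (Suc i))))) \<le> curve_length \<gamma> a b"
  unfolding curve_length_def
  by (rule SUP_upper2[where i="(n,t)"]) (use assms in auto)

lemma curve_length_least:
  assumes "\<And>n t. t 0 = a \<Longrightarrow> t n = b \<Longrightarrow> mono_on {..n} t \<Longrightarrow>
    (\<Sum>i<n. ennreal (d (\<gamma> (t i)) (\<gamma> (t (Suc i))))) \<le> c"
  shows "curve_length \<gamma> a b \<le> c"
  unfolding curve_length_def by (rule SUP_least) (use assms in auto)

lemma dist_le_curve_length:
  assumes "a \<le> b"
  shows "ennreal (d (\<gamma> a) (\<gamma> b)) \<le> curve_length \<gamma> a b"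
  using partition_le_curve_length[of "\<lambda>i. if i = 0 then a else b" a 1 b \<gamma>] assms
  by (auto simp: mono_on_def)

text \<open>Gluing partitions of the two intervals at \<open>b\<close> gives a partition of the
  whole interval, and the sums add up.\<close>

lemma curve_length_superadditive:
  assumes "a \<le> b" "b \<le> c"
  shows "curve_length \<gamma> a b + curve_length \<gamma> b c \<le> curve_length \<gamma> a c"
proof -
  let ?P = "\<lambda>a b. {(n::nat, t::nat \<Rightarrow> real). t 0 = a \<and> t n = b \<and> mono_on {..n} t}"
  let ?S = "\<lambda>n t. \<Sum>i<n. ennreal (d (\<gamma> (t i)) (\<gamma> (t (Suc i))))"
  \<comment> \<open>In \<open>ennreal\<close> a summand moves into a supremum only over a nonempty
    index set.\<close>
  have ne: "?P x y \<noteq> {}" if "x \<le> y" for x y :: real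
  proof -
    have "(1, \<lambda>i. if i = 0 then x else y) \<in> ?P x y" using that by (auto simp: mono_on_def)
    then show ?thesis by blast
  qed
  have concat: "?S n t + ?S m s \<le> curve_length \<gamma> a c"
    if t: "t 0 = a" "t n = b" "mono_on {..n} t" and s: "s 0 = b" "s m = c" "mono_on {..m} s"
    for n m t s
  proof -
    define u where "u i = (if i \<le> n then t i else s (i - n))" for i
    have u: "u (n + i) = s i" for i using t s by (auto simp: u_def)
    have "mono_on {..n + m} u"
    proof (rule mono_onI)
      fix i j assume ij: "i \<in> {..n+m}" "j \<in> {..n+m}" "i \<le> j"
      consider "j \<le> n" | "i \<le> n" "n < j" | "n < i" using ij by linarith
      then show "u i \<le> u j"
      proof cases
        case 1 then show ?thesis using ij t(3) by (auto simp: u_def mono_on_def)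
      next
        case 2
        have "t i \<le> t n" using 2 t(3) by (auto simp: mono_on_def)
        moreover have "s 0 \<le> s (j - n)" using 2 ij s(3) by (auto simp: mono_on_def)
        ultimately show ?thesis using 2 t s by (simp add: u_def)
      next
        case 3
        then have "s (i - n) \<le> s (j - n)" using ij by (intro monotone_onD[OF s(3)]) auto
        then show ?thesis using 3 ij by (simp add: u_def)
      qed
    qed
    moreover have "u 0 = a" "u (n + m) = c" using t s u[of m] by (auto simp: u_def)
    ultimately have "?S (n + m) u \<le> curve_length \<gamma> a c"
      by (intro partition_le_curve_length)
    moreover have "?S (n + m) u = ?S n u + (\<Sum>i<m. ennreal (d (\<gamma> (u (n + i))) (\<gamma> (u (Suc (n + i))))))"
      by (induction m) (auto simp: add.assoc)
    moreover have "?S n u = ?S n t" by (rule sum.cong) (auto simp: u_def)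
    moreover have "(\<Sum>i<m. ennreal (d (\<gamma> (u (n + i))) (\<gamma> (u (Suc (n + i)))))) = ?S m s"
      using u by (intro sum.cong) (auto simp flip: add_Suc_right)
    ultimately show ?thesis by simp
  qed
  have "curve_length \<gamma> a b + curve_length \<gamma> b c
      = (SUP p\<in>?P a b. (SUP q\<in>?P b c. (case p of (n,t) \<Rightarrow> ?S n t) + (case q of (n,t) \<Rightarrow> ?S n t)))"
    unfolding curve_length_def using assms
    by (subst ennreal_SUP_add_left[symmetric, OF ne]) (auto intro!: SUP_cong simp: ennreal_SUP_add_right[OF ne])
  also have "\<dots> \<le> curve_length \<gamma> a c"
    using concat by (intro SUP_least) auto
  finally show ?thesis .
qed

lemma curve_length_mono:
  assumes "a \<le> b" "b \<le> c" "c \<le> e"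
  shows "curve_length \<gamma> b c \<le> curve_length \<gamma> a e"
proof -
  have "curve_length \<gamma> b c \<le> curve_length \<gamma> a b + curve_length \<gamma> b c" by simp
  also have "\<dots> \<le> curve_length \<gamma> a c" using assms by (intro curve_length_superadditive)
  also have "\<dots> \<le> curve_length \<gamma> a c + curve_length \<gamma> c e" by simp
  also have "\<dots> \<le> curve_length \<gamma> a e" using assms by (intro curve_length_superadditive) auto
  finally show ?thesis .
qed

text \<open>By the triangle inequality in \<open>M\<close>, inserting \<open>b\<close> into a
  partition does not lower its sum.\<close>

lemma curve_length_subadditive:
  assumes \<gamma>: "\<And>t. t \<in> {a..c} \<Longrightarrow> \<gamma> t \<in> M" and "a \<le> b" "b \<le> c"
  shows "curve_length \<gamma> a c \<le> curve_length \<gamma> a b + curve_length \<gamma> b c"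
proof -
  \<comment> \<open>The right endpoint \<open>t n\<close> is left free in \<open>{b..c}\<close>, so
    that induction can remove subintervals from the right until one of them contains
    \<open>b\<close>.\<close>
  have "(\<Sum>i<n. ennreal (d (\<gamma> (t i)) (\<gamma> (t (Suc i))))) \<le> curve_length \<gamma> a b + curve_length \<gamma> b (t n)"
    if "t 0 = a" "mono_on {..n} t" "b \<le> t n" "t n \<le> c" for n t b
    using that
  proof (induction n arbitrary: b)
    case 0
    then show ?case by simp
  next
    case (Suc n)
    have m: "mono_on {..n} t" using Suc.prems by (auto simp: mono_on_def)
    have le: "t 0 \<le> t n" "t n \<le> t (Suc n)" using Suc.prems by (auto simp: mono_on_def)
    show ?case
    proof (cases "b \<le> t n")
      case True
      have "(\<Sum>i<Suc n. ennreal (d (\<gamma> (t i)) (\<gamma> (t (Suc i)))))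
          \<le> (curve_length \<gamma> a b + curve_length \<gamma> b (t n)) + curve_length \<gamma> (t n) (t (Suc n))"
        using Suc.IH[OF _ m True] Suc.prems le
        by (auto intro!: add_mono dist_le_curve_length)
      also have "\<dots> \<le> curve_length \<gamma> a b + curve_length \<gamma> b (t (Suc n))"
        using True le by (auto simp: add.assoc intro!: add_left_mono curve_length_superadditive)
      finally show ?thesis .
    next
      \<comment> \<open>The last subinterval contains \<open>b\<close>: its chord is split there,
        and superadditivity joins the first half to the length up to \<open>t n\<close>.\<close>
      case False
      have "curve_length \<gamma> a (t n) + curve_length \<gamma> (t n) (t n) \<le> curve_length \<gamma> a (t n)"
        using le Suc.prems by (intro curve_length_superadditive) auto
      moreover have "(\<Sum>i<n. ennreal (d (\<gamma> (t i)) (\<gamma> (t (Suc i))))) \<le> curve_length \<gamma> a (t n)"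
        using Suc.prems m by (intro partition_le_curve_length) auto
      moreover have "d (\<gamma> (t n)) (\<gamma> (t (Suc n))) \<le> d (\<gamma> (t n)) (\<gamma> b) + d (\<gamma> b) (\<gamma> (t (Suc n)))"
        using Suc.prems le False by (intro triangle \<gamma>) auto
      hence "ennreal (d (\<gamma> (t n)) (\<gamma> (t (Suc n)))) \<le> ennreal (d (\<gamma> (t n)) (\<gamma> b)) + ennreal (d (\<gamma> b) (\<gamma> (t (Suc n))))"
        by (simp flip: ennreal_plus)
      ultimately have "(\<Sum>i<Suc n. ennreal (d (\<gamma> (t i)) (\<gamma> (t (Suc i)))))
          \<le> curve_length \<gamma> a (t n) + (ennreal (d (\<gamma> (t n)) (\<gamma> b)) + ennreal (d (\<gamma> b) (\<gamma> (t (Suc n)))))"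
        by (simp add: add_mono)
      also have "\<dots> \<le> curve_length \<gamma> a (t n) + (curve_length \<gamma> (t n) b + curve_length \<gamma> b (t (Suc n)))"
        using False Suc.prems by (intro add_left_mono add_mono dist_le_curve_length) auto
      also have "\<dots> \<le> curve_length \<gamma> a b + curve_length \<gamma> b (t (Suc n))"
        unfolding add.assoc[symmetric]
        using False Suc.prems le by (intro add_right_mono curve_length_superadditive) auto
      finally show ?thesis .
    qed
  qed
  from this[of _ _ b] show ?thesis
    using assms by (intro curve_length_least) auto
qed

text \<open>Continuity into \<open>mtopology\<close> is turned into real limits: the distance is a
  continuous real function on the square of the parameter interval.\<close>

lemma tendsto_mdist_curve:
  assumes "continuous_map (top_of_set {a..b}) mtopology \<gamma>"
    and "(f \<longlongrightarrow> x) F" "(g \<longlongrightarrow> y) F" "x \<in> {a..b}" "y \<in> {a..b}"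
    and "eventually (\<lambda>s. f s \<in> {a..b}) F" "eventually (\<lambda>s. g s \<in> {a..b}) F"
  shows "((\<lambda>s. d (\<gamma> (f s)) (\<gamma> (g s))) \<longlongrightarrow> d (\<gamma> x) (\<gamma> y)) F"
proof -
  let ?S = "{a..b} \<times> {a..b}"
  have proj: "continuous_map (top_of_set ?S) mtopology (\<lambda>p. \<gamma> (fst p))"
    "continuous_map (top_of_set ?S) mtopology (\<lambda>p. \<gamma> (snd p))"
    using continuous_map_compose[OF _ assms(1), of "top_of_set ?S" fst]
      continuous_map_compose[OF _ assms(1), of "top_of_set ?S" snd]
    by (auto simp: o_def continuous_on_fst continuous_on_snd Pi_iff)
  have "continuous_map (top_of_set ?S) euclidean (\<lambda>p. d (\<gamma> (fst p)) (\<gamma> (snd p)))"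
    using continuous_map_mdist[of "top_of_set ?S" Self] proj by (simp add: mtopology_of_def del: continuous_map_iff_continuous)
  then have "continuous_on ?S (\<lambda>p. d (\<gamma> (fst p)) (\<gamma> (snd p)))" by simp
  from continuous_on_tendsto_compose[OF this tendsto_Pair[OF assms(2,3)]] show ?thesis
    using assms(4-) eventually_conj[OF assms(6,7)] by (auto elim: eventually_mono)
qed

text \<open>A partition of \<open>[a,b]\<close> capped at \<open>s\<close> is a partition of
  \<open>[a,s]\<close>, and its sum tends to the original one as \<open>s\<close> tends to
  \<open>b\<close> from the left.\<close>

lemma curve_length_left_lsc:
  assumes \<gamma>: "continuous_map (top_of_set {a..b}) mtopology \<gamma>" and "a < b"
    and le: "\<And>s. a \<le> s \<Longrightarrow> s < b \<Longrightarrow> curve_length \<gamma> a s \<le> c"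
  shows "curve_length \<gamma> a b \<le> c"
proof (rule curve_length_least)
  fix n :: nat and t assume t: "t 0 = a" "t n = b" "mono_on {..n} t"
  have tin: "t i \<in> {a..b}" if "i \<le> n" for i
    using t that monotone_onD[OF t(3), of 0 i] monotone_onD[OF t(3), of i n] by auto
  have ev: "eventually (\<lambda>s. a \<le> s \<and> s < b) (at_left b)"
    using \<open>a < b\<close> by (auto simp: eventually_at_left intro: exI[of _ a])
  have "((\<lambda>s. \<Sum>i<n. ennreal (d (\<gamma> (min (t i) s)) (\<gamma> (min (t (Suc i)) s))))
      \<longlongrightarrow> (\<Sum>i<n. ennreal (d (\<gamma> (t i)) (\<gamma> (t (Suc i)))))) (at_left b)"
  proof (intro tendsto_sum tendsto_ennrealI tendsto_mdist_curve[OF \<gamma>])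
    fix i assume "i \<in> {..<n}"
    then have i: "t i \<in> {a..b}" "t (Suc i) \<in> {a..b}" using tin by auto
    then show "t i \<in> {a..b}" "t (Suc i) \<in> {a..b}" by auto
    have "((\<lambda>s. min u s) \<longlongrightarrow> min u b) (at_left b)" for u :: real
      by (intro tendsto_intros)
    then show "((\<lambda>s. min (t i) s) \<longlongrightarrow> t i) (at_left b)" "((\<lambda>s. min (t (Suc i)) s) \<longlongrightarrow> t (Suc i)) (at_left b)"
      using i by (metis atLeastAtMost_iff min.absorb1)+
    show "eventually (\<lambda>s. min (t i) s \<in> {a..b}) (at_left b)"
      "eventually (\<lambda>s. min (t (Suc i)) s \<in> {a..b}) (at_left b)"
      using ev i by (auto elim!: eventually_mono)
  qed
  moreover have "eventually (\<lambda>s. (\<Sum>i<n. ennreal (d (\<gamma> (min (t i) s)) (\<gamma> (min (t (Suc i)) s)))) \<le> c) (at_left b)"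
    using ev
  proof eventually_elim
    case (elim s)
    have "mono_on {..n} (\<lambda>i. min (t i) s)"
      by (intro mono_onI min.mono monotone_onD[OF t(3)]) auto
    then show ?case
      using t elim by (intro order_trans[OF partition_le_curve_length le, of "\<lambda>i. min (t i) s"]) auto
  qed
  ultimately show "(\<Sum>i<n. ennreal (d (\<gamma> (t i)) (\<gamma> (t (Suc i))))) \<le> c"
    by (intro tendsto_upperbound) auto
qed

text \<open>The mirror image: partition points are raised to at least \<open>s\<close>, and
  \<open>s\<close> decreases to \<open>a\<close>.\<close>

lemma curve_length_right_lsc:
  assumes \<gamma>: "continuous_map (top_of_set {a..b}) mtopology \<gamma>" and "a < b"
    and le: "\<And>s. a < s \<Longrightarrow> s \<le> b \<Longrightarrow> curve_length \<gamma> s b \<le> c"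
  shows "curve_length \<gamma> a b \<le> c"
proof (rule curve_length_least)
  fix n :: nat and t assume t: "t 0 = a" "t n = b" "mono_on {..n} t"
  have tin: "t i \<in> {a..b}" if "i \<le> n" for i
    using t that monotone_onD[OF t(3), of 0 i] monotone_onD[OF t(3), of i n] by auto
  have ev: "eventually (\<lambda>s. a < s \<and> s \<le> b) (at_right a)"
    using \<open>a < b\<close> by (auto simp: eventually_at_right intro: exI[of _ b])
  have "((\<lambda>s. \<Sum>i<n. ennreal (d (\<gamma> (max (t i) s)) (\<gamma> (max (t (Suc i)) s))))
      \<longlongrightarrow> (\<Sum>i<n. ennreal (d (\<gamma> (t i)) (\<gamma> (t (Suc i)))))) (at_right a)"
  proof (intro tendsto_sum tendsto_ennrealI tendsto_mdist_curve[OF \<gamma>])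
    fix i assume "i \<in> {..<n}"
    then have i: "t i \<in> {a..b}" "t (Suc i) \<in> {a..b}" using tin by auto
    then show "t i \<in> {a..b}" "t (Suc i) \<in> {a..b}" by auto
    have "((\<lambda>s. max u s) \<longlongrightarrow> max u a) (at_right a)" for u :: real
      by (intro tendsto_intros)
    then show "((\<lambda>s. max (t i) s) \<longlongrightarrow> t i) (at_right a)" "((\<lambda>s. max (t (Suc i)) s) \<longlongrightarrow> t (Suc i)) (at_right a)"
      using i by (metis atLeastAtMost_iff max.absorb1)+
    show "eventually (\<lambda>s. max (t i) s \<in> {a..b}) (at_right a)"
      "eventually (\<lambda>s. max (t (Suc i)) s \<in> {a..b}) (at_right a)"
      using ev i by (auto elim!: eventually_mono)
  qed
  moreover have "eventually (\<lambda>s. (\<Sum>i<n. ennreal (d (\<gamma> (max (t i) s)) (\<gamma> (max (t (Suc i)) s)))) \<le> c) (at_right a)"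
    using ev
  proof eventually_elim
    case (elim s)
    have "mono_on {..n} (\<lambda>i. max (t i) s)"
      by (intro mono_onI max.mono monotone_onD[OF t(3)]) auto
    then show ?case
      using t elim by (intro order_trans[OF partition_le_curve_length le, of "\<lambda>i. max (t i) s"]) auto
  qed
  ultimately show "(\<Sum>i<n. ennreal (d (\<gamma> (t i)) (\<gamma> (t (Suc i))))) \<le> c"
    by (intro tendsto_upperbound) auto
qed

text \<open>An intermediate value property, which ensures that the choice in
  \<open>arc_length_param\<close> has a candidate. For the largest parameter \<open>t\<close> of
  length at most \<open>s\<close>, one inequality is left semicontinuity; the other bounds the
  length of the remaining piece.\<close>

lemma curve_length_attains:
  assumes \<gamma>: "continuous_map (top_of_set {0..l}) mtopology \<gamma>" and "0 \<le> l"
    and fin: "curve_length \<gamma> 0 l < top" and s: "s \<le> curve_length \<gamma> 0 l"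
  obtains t where "t \<in> {0..l}" "curve_length \<gamma> 0 t = s"
proof -
  have inM: "\<gamma> t \<in> M" if "t \<in> {0..l}" for t
    using continuous_map_image_subset_topspace[OF \<gamma>] that by auto
  have sub: "continuous_map (top_of_set {a..b}) mtopology \<gamma>" if "0 \<le> a" "b \<le> l" for a b
    using that by (intro continuous_map_from_subtopology_mono[OF \<gamma>]) auto
  have zero: "curve_length \<gamma> 0 0 = 0"
  proof -
    have const: "t i = 0" if "t 0 = 0" "t n = 0" "mono_on {..n} t" "i \<le> n" for t :: "nat \<Rightarrow> real" and n i
      using that monotone_onD[OF that(3), of 0 i] monotone_onD[OF that(3), of i n] by auto
    have "(\<Sum>i<n. ennreal (d (\<gamma> (t i)) (\<gamma> (t (Suc i))))) = 0"
      if "t 0 = 0" "t n = 0" "mono_on {..n} t" for t :: "nat \<Rightarrow> real" and n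
      using that const[of t n] inM[of 0] \<open>0 \<le> l\<close> by (intro sum.neutral) auto
    then have "curve_length \<gamma> 0 0 \<le> 0"
      by (intro curve_length_least) simp
    then show ?thesis by simp
  qed
  define T where "T = {t \<in> {0..l}. curve_length \<gamma> 0 t \<le> s}"
  define t where "t = Sup T"
  have T: "0 \<in> T" "bdd_above T" using zero \<open>0 \<le> l\<close> by (auto simp: T_def)
  have t: "0 \<le> t" "t \<le> l" using T by (auto simp: t_def T_def intro!: cSup_upper cSup_least)
  have below: "curve_length \<gamma> 0 u \<le> s" if u: "0 \<le> u" "u < t" for u
  proof -
    obtain v where v: "v \<in> T" "u < v" using less_cSupD[of T u] T u by (auto simp: t_def)
    then show ?thesis
      using curve_length_mono[of 0 0 u v \<gamma>] u by (auto simp: T_def)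
  qed
  have le: "curve_length \<gamma> 0 t \<le> s"
  proof (cases "t = 0")
    case False
    then have "0 < t" using t by simp
    show ?thesis by (rule curve_length_left_lsc[OF sub \<open>0 < t\<close>]) (use t below in auto)
  qed (simp add: zero)
  have "s \<le> curve_length \<gamma> 0 t"
  proof (cases "t = l")
    case False
    \<comment> \<open>Beyond \<open>t\<close> the length exceeds \<open>s\<close>, so at most the
      total minus \<open>s\<close> remains; right semicontinuity carries this over to the piece
      starting at \<open>t\<close>.\<close>
    have above: "curve_length \<gamma> u l \<le> curve_length \<gamma> 0 l - s" if u: "t < u" "u \<le> l" for u
    proof -
      have "u \<notin> T" using u T cSup_upper[of u T] by (auto simp: t_def)
      then have "s \<le> curve_length \<gamma> 0 u" using u t by (auto simp: T_def)
      then have "s + curve_length \<gamma> u l \<le> curve_length \<gamma> 0 l"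
        using u t curve_length_superadditive[of 0 u l \<gamma>] by (meson add_right_mono dual_order.trans less_imp_le)
      then show ?thesis by (rule ennreal_le_diffI) (rule fin)
    qed
    have "curve_length \<gamma> t l \<le> curve_length \<gamma> 0 l - s"
    proof (rule curve_length_right_lsc[OF sub])
      show "t < l" using t False by simp
    qed (use t above in auto)
    then have "curve_length \<gamma> 0 l \<le> curve_length \<gamma> 0 t + (curve_length \<gamma> 0 l - s)"
      using curve_length_subadditive[of 0 l \<gamma> t] inM t by (meson add_left_mono order_trans)
    then show ?thesis by (rule ennreal_le_of_diff_le) (rule s, rule fin)
  qed (use s in simp)
  then show ?thesis using that[of t] le t by auto
qed

end

subsection \<open>Cutoff functions\<close>

text \<open>Take the first time \<open>t\<close> at level \<open>q\<close> and then the last time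
  \<open>s\<close> before \<open>t\<close> at level \<open>p\<close>; in between, the intermediate
  value theorem confines \<open>u\<close> to \<open>{p..q}\<close>.\<close>

lemma continuous_crossing:
  fixes u :: "real \<Rightarrow> real"
  assumes "continuous_on {0..l} u" "0 \<le> l" "p < q" "u 0 \<le> p" "q \<le> u l"
  obtains s t where "0 \<le> s" "s \<le> t" "t \<le> l" "u s = p" "u t = q" "\<And>r. r \<in> {s..t} \<Longrightarrow> u r \<in> {p..q}"
proof -
  have attained: "\<exists>x\<in>{a..b}. u x = z" if "0 \<le> a" "a \<le> b" "b \<le> l" "u a \<le> z" "z \<le> u b" for a b z
    using IVT'[of u a z b] that continuous_on_subset[OF assms(1), of "{a..b}"] by auto
  define t where "t = Inf {x\<in>{0..l}. u x = q}"
  have cl: "closed {x\<in>{0..l}. u x = q}"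
    using continuous_closed_preimage_constant[OF assms(1)] by simp
  have ne: "{x\<in>{0..l}. u x = q} \<noteq> {}" using attained[of 0 l q] assms by auto
  have bd: "bdd_below {x\<in>{0..l}. u x = q}" by (auto intro: bdd_belowI[of _ 0])
  have t: "t \<in> {0..l}" "u t = q"
    using closed_contains_Inf[OF ne bd cl] by (auto simp: t_def)
  have tmin: "u x < q" if "0 \<le> x" "x < t" for x
  proof (rule ccontr)
    assume "\<not> u x < q"
    then have "\<exists>z\<in>{0..x}. u z = q" using that t assms(3,4) by (intro attained) auto
    then obtain z where "z \<in> {0..x}" "u z = q" by blast
    then show False using cInf_lower[OF _ bd, of z] that t by (auto simp: t_def)
  qed
  define s where "s = Sup {x\<in>{0..t}. u x = p}"
  have cl: "closed {x\<in>{0..t}. u x = p}"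
    using continuous_closed_preimage_constant[OF continuous_on_subset[OF assms(1), of "{0..t}"]] t by simp
  have ne: "{x\<in>{0..t}. u x = p} \<noteq> {}" using attained[of 0 t p] assms t by auto
  have bd: "bdd_above {x\<in>{0..t}. u x = p}" by (auto intro: bdd_aboveI[of _ t])
  have s: "s \<in> {0..t}" "u s = p"
    using closed_contains_Sup[OF ne bd cl] by (auto simp: s_def)
  have smax: "p < u x" if "s < x" "x \<le> t" for x
  proof (rule ccontr)
    assume "\<not> p < u x"
    then have "\<exists>z\<in>{x..t}. u z = p" using that s t assms(3) by (intro attained) auto
    then obtain z where "z \<in> {x..t}" "u z = p" by blast
    then show False using cSup_upper[OF _ bd, of z] that s by (auto simp: s_def)
  qed
  have "u r \<in> {p..q}" if "r \<in> {s..t}" for r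
    using smax[of r] tmin[of r] that s t assms(3) by (cases "r = s"; cases "r = t") (auto intro: less_imp_le)
  then show ?thesis using that[of s t] s t by auto
qed

text \<open>With \<open>u\<close> the distance from a center along a curve, the change of a radial
  cutoff is realized on a piece that stays in the closed annulus. The levels of the crossing are the
  clamped end values; a decrease is treated through \<open>- u\<close>.\<close>

lemma clamp_crossing:
  fixes u :: "real \<Rightarrow> real"
  assumes u: "continuous_on {0..l} u" "0 \<le> l" and "a \<le> b"
    and ne: "max a (min b (u 0)) \<noteq> max a (min b (u l))"
  obtains s t where "0 \<le> s" "s \<le> t" "t \<le> l" "\<And>r. r \<in> {s..t} \<Longrightarrow> u r \<in> {a..b}"
    "\<bar>max a (min b (u 0)) - max a (min b (u l))\<bar> = \<bar>u s - u t\<bar>"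
proof -
  consider "max a (min b (u 0)) < max a (min b (u l))" | "max a (min b (u l)) < max a (min b (u 0))"
    using ne by linarith
  then show ?thesis
  proof cases
    case 1
    \<comment> \<open>The strict inequality puts the lower clamped value below \<open>b\<close>,
      hence at or above \<open>u 0\<close>, and the upper one above \<open>a\<close>, hence at or
      below \<open>u l\<close>.\<close>
    obtain s t where st: "0 \<le> s" "s \<le> t" "t \<le> l" "u s = max a (min b (u 0))" "u t = max a (min b (u l))"
      "\<And>r. r \<in> {s..t} \<Longrightarrow> u r \<in> {max a (min b (u 0))..max a (min b (u l))}"
      using 1 \<open>a \<le> b\<close> by (elim continuous_crossing[OF u 1, rotated 2]) auto
    have "u r \<in> {a..b}" if "r \<in> {s..t}" for r using st(6)[OF that] \<open>a \<le> b\<close> by auto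
    then show ?thesis using st by (intro that[of s t]) auto
  next
    case 2
    have c: "continuous_on {0..l} (\<lambda>x. - u x)" using u by (intro continuous_intros)
    obtain s t where st: "0 \<le> s" "s \<le> t" "t \<le> l" "- u s = - max a (min b (u 0))" "- u t = - max a (min b (u l))"
      "\<And>r. r \<in> {s..t} \<Longrightarrow> - u r \<in> {- max a (min b (u 0))..- max a (min b (u l))}"
      using 2 \<open>a \<le> b\<close> by (elim continuous_crossing[OF c u(2), of "- max a (min b (u 0))" "- max a (min b (u l))", rotated 3]) auto
    have "u r \<in> {a..b}" if "r \<in> {s..t}" for r using st(6)[OF that] \<open>a \<le> b\<close> by auto
    then show ?thesis using st by (intro that[of s t]) auto
  qed
qed

section \<open>Radial cutoffs: upper gradients and the Sobolev test\<close>

context Metric_space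
begin

text \<open>The parameter picked by \<open>SOME\<close> may lie outside \<open>{s..t}\<close>, but
  then the length is constant between it and the nearer endpoint, and the curve does not move
  there.\<close>

lemma arc_length_param_in_closed_piece:
  assumes \<gamma>: "curve \<gamma> l" and st: "0 \<le> s" "s \<le> t" "t \<le> l"
    and A: "\<And>r. r \<in> {s..t} \<Longrightarrow> \<gamma> r \<in> A"
    and x: "0 \<le> x" "ennreal x \<in> {curve_length \<gamma> 0 s..curve_length \<gamma> 0 t}"
  shows "arc_length_param \<gamma> l x \<in> A"
proof -
  have cont: "continuous_map (top_of_set {0..l}) mtopology \<gamma>" and l: "0 < l"
    and fin: "curve_length \<gamma> 0 l < top"
    using \<gamma> by (auto simp: curve_def)
  have inM: "\<gamma> t \<in> M" if "t \<in> {0..l}" for t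
    using continuous_map_image_subset_topspace[OF cont] that by auto
  \<comment> \<open>Finite total length allows cancelling in \<open>ennreal\<close>, so the length
    between \<open>v\<close> and \<open>w\<close> is \<open>0\<close>.\<close>
  have eqI: "\<gamma> v = \<gamma> w"
    if "0 \<le> v" "v \<le> w" "w \<le> l" "curve_length \<gamma> 0 w \<le> curve_length \<gamma> 0 v" for v w
  proof -
    have "curve_length \<gamma> 0 v \<le> curve_length \<gamma> 0 l" using that by (intro curve_length_mono) auto
    then have "curve_length \<gamma> 0 v \<noteq> top" using fin by auto
    moreover have "curve_length \<gamma> 0 v + curve_length \<gamma> v w \<le> curve_length \<gamma> 0 v"
      using curve_length_superadditive[of 0 v w \<gamma>] that by (meson order_trans)
    then have "curve_length \<gamma> 0 v + curve_length \<gamma> v w \<le> curve_length \<gamma> 0 v + 0" by simp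
    ultimately have "curve_length \<gamma> v w \<le> 0"
      by (simp add: ennreal_add_left_cancel_le del: add_0_right)
    then have "d (\<gamma> v) (\<gamma> w) = 0"
      using dist_le_curve_length[of v w \<gamma>] that nonneg[of "\<gamma> v" "\<gamma> w"] by (simp add: ennreal_eq_0_iff antisym)
    then show ?thesis using zero inM that by auto
  qed
  define r where "r = (SOME r. r \<in> {0..l} \<and> curve_length \<gamma> 0 r = ennreal x)"
  have "curve_length \<gamma> 0 t \<le> curve_length \<gamma> 0 l" using st by (intro curve_length_mono) auto
  then have "\<exists>r. r \<in> {0..l} \<and> curve_length \<gamma> 0 r = ennreal x"
    using curve_length_attains[OF cont _ fin, of "ennreal x"] l x by (auto intro: order_trans)
  then have r: "r \<in> {0..l}" "curve_length \<gamma> 0 r = ennreal x"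
    using someI_ex[of "\<lambda>r. r \<in> {0..l} \<and> curve_length \<gamma> 0 r = ennreal x"] unfolding r_def by blast+
  consider "r \<in> {s..t}" | "r < s" | "t < r" by force
  then have "\<gamma> r \<in> A"
  proof cases
    case 2
    then show ?thesis using eqI[of r s] A[of s] r x st by auto
  next
    case 3
    then show ?thesis using eqI[of t r] A[of t] r x st by auto
  qed (rule A)
  then show ?thesis by (simp add: arc_length_param_def r_def)
qed

lemma continuous_on_mdist_curve:
  assumes "continuous_map (top_of_set {a..b}) mtopology \<gamma>" "y \<in> M"
  shows "continuous_on {a..b} (\<lambda>t. d y (\<gamma> t))"
  using continuous_map_mdist[of "top_of_set {a..b}" Self "\<lambda>_. y" \<gamma>] assms
  by (simp add: mtopology_of_def)

lemma measurable_mdist: "y \<in> M \<Longrightarrow> d y \<in> borel_measurable metric_borel"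
proof -
  assume y: "y \<in> M"
  have "continuous_map mtopology euclidean (d y)"
    using continuous_map_mdist[of mtopology Self "\<lambda>_. y" "\<lambda>x. x"] y
    by (simp add: mtopology_of_def)
  then have "d y -` S \<inter> M \<in> {U. openin mtopology U}" if "open S" for S
    using that by (auto simp: continuous_map_def vimage_def Collect_conj_eq[symmetric] conj_commute Int_def)
  moreover have "{U. openin mtopology U} \<subseteq> Pow M" using openin_subset by fastforce
  ultimately show ?thesis
    unfolding metric_borel_def by (intro borel_measurableI) (auto simp: space_measure_of)
qed

text \<open>If the cutoff differs at the ends of a curve, some piece in the closed annulus is at
  least as long as the change of the clamped distance. On its arc-length interval the gradient is
  \<open>1 / (b - a)\<close>; the closed annulus also covers the endpoints of the piece.\<close>

lemma upper_gradient_cutoff: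
  assumes y: "y \<in> M" and ab: "a < b"
  shows "upper_gradient (\<lambda>x. ereal ((b - max a (min b (d y x))) / (b - a)))
    (\<lambda>x. ennreal (1 / (b - a)) * indicator {x. d y x \<in> {a..b}} x)"
    (is "upper_gradient ?w ?g")
  unfolding upper_gradient_def
proof (intro conjI allI impI)
  note [measurable] = measurable_mdist[OF y]
  show "?g \<in> borel_measurable metric_borel" by measurable
  fix \<gamma> l assume \<gamma>: "curve \<gamma> l"
  have cont: "continuous_map (top_of_set {0..l}) mtopology \<gamma>" and l: "0 < l"
    and fin: "curve_length \<gamma> 0 l < top"
    using \<gamma> by (auto simp: curve_def)
  have inM: "\<gamma> t \<in> M" if "t \<in> {0..l}" for t
    using continuous_map_image_subset_topspace[OF cont] that by auto
  define u where "u t = d y (\<gamma> t)" for t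
  let ?c = "\<lambda>z. max a (min b z)"
  have "ennreal \<bar>(b - ?c (u 0)) / (b - a) - (b - ?c (u l)) / (b - a)\<bar> \<le> line_integral ?g \<gamma> l"
  proof (cases "?c (u 0) = ?c (u l)")
    case False
    have "continuous_on {0..l} u"
      unfolding u_def by (rule continuous_on_mdist_curve[OF cont y])
    then obtain s t where st: "0 \<le> s" "s \<le> t" "t \<le> l" "\<And>r. r \<in> {s..t} \<Longrightarrow> u r \<in> {a..b}"
      and eq: "\<bar>?c (u 0) - ?c (u l)\<bar> = \<bar>u s - u t\<bar>"
      using clamp_crossing[OF _ _ _ False] l ab by auto
    \<comment> \<open>Arc length as a real function; \<open>{v s..v t}\<close> is the arc-length
      interval of the crossing piece.\<close>
    define v where "v t = enn2real (curve_length \<gamma> 0 t)" for t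
    have v: "curve_length \<gamma> 0 t = ennreal (v t)" "v t \<le> v l" if "t \<in> {0..l}" for t
    proof -
      have "curve_length \<gamma> 0 t \<le> curve_length \<gamma> 0 l" using that by (intro curve_length_mono) auto
      then show "curve_length \<gamma> 0 t = ennreal (v t)" "v t \<le> v l"
        using fin by (auto simp: v_def enn2real_mono)
    qed
    have v0: "0 \<le> v t" for t by (simp add: v_def)
    have inA: "arc_length_param \<gamma> l x \<in> {x. d y x \<in> {a..b}}" if "x \<in> {v s..v t}" for x
    proof (rule arc_length_param_in_closed_piece[OF \<gamma> st(1-3)])
      show "0 \<le> x" using that v0[of s] by simp
      show "ennreal x \<in> {curve_length \<gamma> 0 s..curve_length \<gamma> 0 t}"
        using that st v by (auto intro: ennreal_leI)
    qed (use st in \<open>auto simp: u_def\<close>)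
    \<comment> \<open>The difference of radii is at most the distance of the two points, which is at
      most the length of the piece.\<close>
    have "ennreal (v s) + ennreal (d (\<gamma> s) (\<gamma> t)) \<le> curve_length \<gamma> 0 s + curve_length \<gamma> s t"
      using st v by (intro add_mono dist_le_curve_length) auto
    also have "\<dots> \<le> ennreal (v t)"
      using st v curve_length_superadditive[of 0 s t \<gamma>] by simp
    finally have "d (\<gamma> s) (\<gamma> t) \<le> v t - v s"
      using v0 by (simp flip: ennreal_plus)
    moreover have "\<bar>u s - u t\<bar> \<le> d (\<gamma> s) (\<gamma> t)"
      using mdist_reverse_triangle[of "\<gamma> s" y "\<gamma> t"] inM y st by (simp add: u_def commute)
    ultimately have le: "\<bar>u s - u t\<bar> \<le> v t - v s" by simp
    have "\<bar>(b - ?c (u 0)) / (b - a) - (b - ?c (u l)) / (b - a)\<bar> = 1 / (b - a) * \<bar>u s - u t\<bar>"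
      using eq ab by (simp add: diff_divide_distrib[symmetric] abs_divide abs_minus_commute)
    also have "\<dots> \<le> 1 / (b - a) * (v t - v s)"
      using le ab by (intro mult_left_mono) auto
    finally have "ennreal \<bar>(b - ?c (u 0)) / (b - a) - (b - ?c (u l)) / (b - a)\<bar>
        \<le> ennreal (1 / (b - a)) * emeasure lborel {v s..v t}"
      using le ab by (simp flip: ennreal_mult)
    also have "\<dots> = (\<integral>\<^sup>+x. ennreal (1 / (b - a)) * indicator {v s..v t} x \<partial>lborel)"
      by (simp add: nn_integral_cmult_indicator)
    also have "\<dots> \<le> line_integral ?g \<gamma> l"
      unfolding line_integral_def
    proof (intro nn_integral_mono)
      fix x
      show "ennreal (1 / (b - a)) * indicator {v s..v t} x
          \<le> ?g (arc_length_param \<gamma> l x) * indicator {0..enn2real (curve_length \<gamma> 0 l)} x"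
      proof (cases "x \<in> {v s..v t}")
        case True
        have "v t \<le> v l" using v(2)[of t] st by simp
        then have "x \<in> {0..enn2real (curve_length \<gamma> 0 l)}"
          using True v0[of s] unfolding v_def[of l, symmetric] by simp
        then show ?thesis using inA[OF True] by (simp only: indicator_simps True mult_1_right)
      qed simp
    qed
    finally show ?thesis .
  qed simp
  then have "ereal \<bar>(b - ?c (u 0)) / (b - a) - (b - ?c (u l)) / (b - a)\<bar> \<le> enn2ereal (line_integral ?g \<gamma> l)"
    by (simp only: less_eq_ennreal.rep_eq enn2ereal_ennreal abs_ge_zero)
  then show "\<bar>?w (\<gamma> 0) - ?w (\<gamma> l)\<bar> \<le> enn2ereal (line_integral ?g \<gamma> l)"
    by (simp only: u_def ereal_minus abs_ereal.simps)
qed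

text \<open>Since the cutoff is \<open>1\<close> on \<open>mball y p\<close>, every \<open>k\<close>
  admissible in its Orlicz norm satisfies the premises of \<open>lower\<close>. The bound
  \<open>\<kappa>\<close> stays abstract because large and small measure ratios call for different
  values.\<close>

lemma weak_orlicz_sobolev_cutoff:
  assumes sets: "sets \<mu> = sets metric_borel"
    and y: "y \<in> M" and pq: "p < q" "q \<le> r" "0 < r"
    and pos: "0 < emeasure \<mu> (mball y r)" and fin: "emeasure \<mu> (mball y r) < \<infinity>"
    and nonneg: "\<And>x. 0 \<le> x \<Longrightarrow> 0 \<le> \<Phi> x"
    and sobolev: "weak_orlicz_sobolev \<mu> \<Phi> \<phi> C" and C: "0 \<le> C * \<phi> r"
    and lower: "\<And>k. 0 < k \<Longrightarrow> \<Phi> (1 / k) * measure \<mu> (mball y p) \<le> measure \<mu> (mball y r) \<Longrightarrow> \<kappa> \<le> k"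
  shows "\<kappa> \<le> 2 * C * \<phi> r / (q - p) *
    ((measure \<mu> (mball y q) - measure \<mu> (mball y p)) / measure \<mu> (mball y r))"
proof -
  \<comment> \<open>The cutoff vanishes from the midpoint on, so its support lies in a closed ball
    inside \<open>mball y r\<close> even if \<open>q = r\<close>, and the closed annulus lies inside
    \<open>mball y q\<close>. This costs the factor \<open>2\<close>.\<close>
  define b where "b = (p + q) / 2"
  have b: "p < b" "b < q" using pq by (auto simp: b_def)
  define w where "w x = ereal ((b - max p (min b (d y x))) / (b - p))" for x
  define g where "g x = ennreal (1 / (b - p)) * indicator {x. d y x \<in> {p..b}} x" for x
  define B where "B = mball y r"
  define \<nu> where "\<nu> = uniform_measure \<mu> B"
  have subset: "{U. openin mtopology U} \<subseteq> Pow M" using openin_subset by fastforce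
  have space: "space \<mu> = M"
    using sets_eq_imp_space_eq[OF sets] subset by (simp add: metric_borel_def space_measure_of)
  have ball[measurable]: "mball y s \<in> sets \<mu>" for s
    using subset by (auto simp: sets metric_borel_def)
  have dm[measurable]: "d y \<in> borel_measurable \<mu>"
    using measurable_mdist[OF y] measurable_cong_sets[OF sets refl] by blast
  have wm[measurable]: "w \<in> borel_measurable \<mu>" unfolding w_def by measurable
  have w_bounds: "\<bar>w x\<bar> \<le> 1" for x
    using b by (auto simp: w_def abs_le_iff one_ereal_def)
  have w_outside: "w x = 0" if "x \<in> M" "x \<notin> mcball y b" for x
    using that y b by (auto simp: w_def)
  have cball: "mcball y b \<subseteq> B" using b pq by (auto simp: B_def)
  have grad: "upper_gradient w g"
    unfolding w_def g_def by (rule upper_gradient_cutoff[OF y b(1)])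
  define A where "A = {x \<in> M. d y x \<in> {p..b}}"
  have "A = {x \<in> space \<mu>. d y x \<in> {p..b}}" by (simp add: A_def space)
  then have A[measurable]: "A \<in> sets \<mu>" by simp
  have AB: "A \<subseteq> mball y q - mball y p" "A \<subseteq> B"
    using b pq y by (auto simp: A_def B_def)
  \<comment> \<open>Used for \<open>\<mu>\<close>, to bound the Newtonian norm, and for
    \<open>\<nu>\<close>, on the right side of the inequality.\<close>
  have g_eq: "(\<integral>\<^sup>+x. g x \<partial>N) = ennreal (1 / (b - p)) * emeasure N A" if "space N = M" "sets N = sets \<mu>" for N
  proof -
    have "(\<integral>\<^sup>+x. g x \<partial>N) = (\<integral>\<^sup>+x. ennreal (1 / (b - p)) * indicator A x \<partial>N)"
      using that by (intro nn_integral_cong) (auto simp: g_def A_def indicator_def)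
    then show ?thesis using A that by (simp add: nn_integral_cmult_indicator)
  qed
  have "(\<integral>\<^sup>+x. e2ennreal \<bar>w x\<bar> \<partial>\<mu>) \<le> (\<integral>\<^sup>+x. indicator B x \<partial>\<mu>)"
  proof (rule nn_integral_mono)
    fix x assume "x \<in> space \<mu>"
    have "e2ennreal \<bar>w x\<bar> \<le> e2ennreal 1" using w_bounds by (intro e2ennreal_mono)
    then show "e2ennreal \<bar>w x\<bar> \<le> indicator B x"
      using w_outside[of x] cball \<open>x \<in> space \<mu>\<close> unfolding space
      by (cases "x \<in> B") (auto simp: subset_eq one_ennreal.abs_eq zero_ennreal.abs_eq simp del: in_mcball)
  qed
  also have "\<dots> < top" using fin by (simp add: B_def)
  finally have "(\<integral>\<^sup>+x. e2ennreal \<bar>w x\<bar> \<partial>\<mu>) < top" .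
  moreover have "(INF g \<in> {g. upper_gradient w g}. \<integral>\<^sup>+x. g x \<partial>\<mu>) < top"
  proof (rule le_less_trans[OF INF_lower])
    show "g \<in> {g. upper_gradient w g}" using grad by simp
    have "emeasure \<mu> A < top"
      using emeasure_mono[OF AB(2), of \<mu>] fin by (auto simp: B_def intro: le_less_trans)
    then show "(\<integral>\<^sup>+x. g x \<partial>\<mu>) < top"
      using space by (simp add: g_eq ennreal_mult_less_top)
  qed
  ultimately have "newtonian_norm \<mu> w < top" by (simp add: newtonian_norm_def)
  with wm have w_mem: "w \<in> newtonian_zero \<mu> B"
    using w_outside cball unfolding newtonian_zero_def by blast
  have "support w \<subseteq> mcball y b"
    unfolding support_def using w_outside by (intro closure_of_minimal[OF _ closedin_mcball]) blast
  then have supp: "support w \<subseteq> B" using cball by simp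
  have ms: "measure \<mu> (mball y s) \<le> measure \<mu> (mball y t)" "emeasure \<mu> (mball y s) = ennreal (measure \<mu> (mball y s))"
    if "s \<le> t" "t \<le> r" for s t
  proof -
    have sub: "mball y s \<subseteq> mball y t" "mball y t \<subseteq> B" "mball y s \<subseteq> B" using that by (auto simp: B_def)
    have "emeasure \<mu> (mball y t) < top" "emeasure \<mu> (mball y s) < top"
      using emeasure_mono[OF sub(2), of \<mu>] emeasure_mono[OF sub(3), of \<mu>] fin
      by (auto simp: B_def intro: le_less_trans)
    then show "measure \<mu> (mball y s) \<le> measure \<mu> (mball y t)" "emeasure \<mu> (mball y s) = ennreal (measure \<mu> (mball y s))"
      using sub by (auto intro!: measure_mono_fmeasurable emeasure_eq_ennreal_measure simp: fmeasurable_def)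
  qed
  define m where "m s = measure \<mu> (mball y s)" for s
  have mr: "0 < m r" "emeasure \<mu> B = ennreal (m r)"
    using pos ms(2)[of r r] by (auto simp: m_def B_def)
  have measure_A: "measure \<mu> A \<le> m q - m p"
  proof -
    have fq: "mball y q \<in> fmeasurable \<mu>" using ms(2)[of q q] pq by (auto simp: fmeasurable_def)
    have "measure \<mu> A \<le> measure \<mu> (mball y q - mball y p)"
      using AB fq by (intro measure_mono_fmeasurable) (auto intro: fmeasurable_Diff)
    also have "\<dots> = m q - m p"
      using fq pq mball_subset_concentric[of p q y] unfolding m_def
      by (intro measure_Diff) (simp_all add: fmeasurable_def)
    finally show ?thesis .
  qed
  have emeas: "emeasure \<nu> S = ennreal (measure \<mu> S / m r)" if "S \<in> sets \<mu>" "S \<subseteq> B" for S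
  proof -
    have "emeasure \<mu> S < top" using emeasure_mono[OF that(2), of \<mu>] mr by (auto simp: B_def intro: le_less_trans)
    then have "emeasure \<mu> S = ennreal (measure \<mu> S)" by (intro emeasure_eq_ennreal_measure) auto
    moreover have "B \<inter> S = S" using that by auto
    ultimately show ?thesis
      using that mr by (simp add: \<nu>_def B_def divide_ennreal)
  qed
  have "ennreal \<kappa> \<le> orlicz_norm \<Phi> \<nu> w"
    unfolding orlicz_norm_def
  proof (intro INF_greatest)
    fix k assume "k \<in> {k::real. 0 < k \<and> (\<integral>\<^sup>+x. young_ext \<Phi> (e2ennreal \<bar>w x\<bar> / ennreal k) \<partial>\<nu>) \<le> 1}"
    then have k: "0 < k" "(\<integral>\<^sup>+x. young_ext \<Phi> (e2ennreal \<bar>w x\<bar> / ennreal k) \<partial>\<nu>) \<le> 1" by auto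
    \<comment> \<open>The integral is restricted to \<open>mball y p\<close>, where
      \<open>w = 1\<close>.\<close>
    have "ennreal (\<Phi> (1 / k)) * indicator (mball y p) x \<le> young_ext \<Phi> (e2ennreal \<bar>w x\<bar> / ennreal k)" for x
    proof (cases "x \<in> mball y p")
      case True
      then have "w x = 1" using b by (auto simp: w_def one_ereal_def)
      moreover have "e2ennreal 1 / ennreal k = ennreal (1 / k)"
        using k by (simp add: one_ennreal.abs_eq[symmetric] divide_ennreal[symmetric])
      ultimately show ?thesis using k True by (simp add: young_ext_def del: in_mball)
    qed simp
    then have "(\<integral>\<^sup>+x. ennreal (\<Phi> (1 / k)) * indicator (mball y p) x \<partial>\<nu>) \<le> 1"
      by (intro order_trans[OF nn_integral_mono k(2)])
    moreover have "(\<integral>\<^sup>+x. ennreal (\<Phi> (1 / k)) * indicator (mball y p) x \<partial>\<nu>) = ennreal (\<Phi> (1 / k)) * emeasure \<nu> (mball y p)"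
      by (rule nn_integral_cmult_indicator) (simp add: \<nu>_def)
    moreover have "emeasure \<nu> (mball y p) = ennreal (m p / m r)"
      using emeas[of "mball y p"] mball_subset_concentric[of p r y] pq by (simp add: m_def B_def)
    ultimately have "ennreal (\<Phi> (1 / k)) * ennreal (m p / m r) \<le> 1" by (simp only:)
    moreover have "0 \<le> \<Phi> (1 / k)" using nonneg k by simp
    ultimately have "ennreal (\<Phi> (1 / k) * (m p / m r)) \<le> 1" by (simp only: ennreal_mult')
    then have "\<Phi> (1 / k) * (m p / m r) \<le> 1" by (simp only: ennreal_le_1)
    then have "\<Phi> (1 / k) * m p \<le> m r" using mr by (simp add: field_simps)
    then show "ennreal \<kappa> \<le> ennreal k" using lower[OF k(1)] k(1) by (auto simp: m_def intro: ennreal_leI)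
  qed
  also have "\<dots> \<le> ennreal (C * \<phi> r) * (\<integral>\<^sup>+x. g x \<partial>\<nu>)"
    using sobolev y pq w_mem supp grad by (auto simp: weak_orlicz_sobolev_def \<nu>_def B_def)
  also have "\<dots> = ennreal (C * \<phi> r * (1 / (b - p) * (measure \<mu> A / m r)))"
  proof -
    have "(\<integral>\<^sup>+x. g x \<partial>\<nu>) = ennreal (1 / (b - p)) * ennreal (measure \<mu> A / m r)"
      using emeas[OF A AB(2)] space by (simp add: g_eq \<nu>_def)
    moreover have "0 \<le> 1 / (b - p)" using b by simp
    ultimately show ?thesis using C by (simp only: ennreal_mult')
  qed
  finally have "\<kappa> \<le> C * \<phi> r * (1 / (b - p) * (measure \<mu> A / m r))"
    using C mr b by (subst (asm) ennreal_le_iff) auto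
  also have "\<dots> \<le> C * \<phi> r * (1 / (b - p) * ((m q - m p) / m r))"
    using measure_A C mr b by (intro mult_left_mono divide_right_mono) auto
  also have "\<dots> = 2 * C * \<phi> r / (q - p) * ((m q - m p) / m r)"
  proof -
    have half: "b - p = (q - p) / 2" by (simp add: b_def field_simps)
    show ?thesis unfolding half by simp
  qed
  finally show ?thesis by (simp add: m_def)
qed

end

subsection \<open>Growth of measure ratios of concentric balls\<close>

text \<open>For \<open>t \<le> sqrt s\<close>, a power of \<open>ln s\<close> is absorbed by the
  other factor \<open>sqrt s\<close>; otherwise \<open>ln t\<close> is at least half of
  \<open>ln s\<close>, and the growth condition applies at \<open>t\<close>.\<close>

lemma superlinear_inverse_bound:
  fixes \<alpha> s t :: real
  assumes \<alpha>: "1 \<le> \<alpha>" and s: "1 < s" and le: "\<Phi> t \<le> s"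
    and growth: "\<And>t. 1 < t \<Longrightarrow> t * (ln t) powr \<alpha> \<le> \<Phi> t"
  shows "t * (ln s) powr \<alpha> \<le> (2 * \<alpha>) powr \<alpha> * s"
proof (cases "t \<le> sqrt s")
  case True
  \<comment> \<open>The exponent is chosen so that the power \<alpha> of
    \<open>s powr (1 / (2 * \<alpha>))\<close> is \<open>sqrt s\<close>; with
    \<open>ln x \<le> x\<close> this produces the constant
    \<open>(2 * \<alpha>) powr \<alpha>\<close>.\<close>
  have "ln s = 2 * \<alpha> * ln (s powr (1 / (2 * \<alpha>)))" using \<alpha> s by (simp add: ln_powr)
  also have "\<dots> \<le> 2 * \<alpha> * s powr (1 / (2 * \<alpha>))"
    using \<alpha> s ln_bound[of "s powr (1 / (2 * \<alpha>))"] by (intro mult_left_mono) auto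
  finally have "(ln s) powr \<alpha> \<le> (2 * \<alpha> * s powr (1 / (2 * \<alpha>))) powr \<alpha>"
    using \<alpha> s by (intro powr_mono2) auto
  also have "\<dots> = (2 * \<alpha>) powr \<alpha> * sqrt s"
    using \<alpha> s by (simp add: powr_mult powr_powr powr_half_sqrt)
  finally have "t * (ln s) powr \<alpha> \<le> sqrt s * ((2 * \<alpha>) powr \<alpha> * sqrt s)"
    using True s by (intro mult_mono) auto
  also have "\<dots> = (2 * \<alpha>) powr \<alpha> * (sqrt s * sqrt s)" by (simp only: mult_ac)
  finally show ?thesis using s by simp
next
  case False
  have "1 < sqrt s" using s by simp
  then have t: "1 < t" "sqrt s < t" using False by linarith+
  have "ln s / 2 = ln (sqrt s)" using s by (simp add: ln_sqrt)
  also have "\<dots> \<le> ln t" using s t by simp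
  finally have "ln s \<le> 2 * ln t" by simp
  then have "(ln s) powr \<alpha> \<le> (2 * ln t) powr \<alpha>" using \<alpha> s by (intro powr_mono2) auto
  also have "\<dots> = 2 powr \<alpha> * (ln t) powr \<alpha>" using t by (simp add: powr_mult)
  also have "\<dots> \<le> (2 * \<alpha>) powr \<alpha> * (ln t) powr \<alpha>"
    using \<alpha> by (intro mult_right_mono powr_mono2) auto
  finally have "t * (ln s) powr \<alpha> \<le> t * ((2 * \<alpha>) powr \<alpha> * (ln t) powr \<alpha>)"
    using t by (intro mult_left_mono) auto
  also have "\<dots> = (2 * \<alpha>) powr \<alpha> * (t * (ln t) powr \<alpha>)" by simp
  also have "\<dots> \<le> (2 * \<alpha>) powr \<alpha> * s"
    using growth[OF t(1)] le by (intro mult_left_mono) auto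
  finally show ?thesis .
qed

text \<open>Mean value theorem, with an intermediate point below \<open>l + 1 \<le> 2 * l\<close>.
  It compares a radius decrement of order \<open>l powr (- \<alpha>)\<close> with a telescoping
  difference.\<close>

lemma powr_diff_lower_bound:
  fixes l \<alpha> :: real
  assumes "1 < \<alpha>" "1 \<le> l"
  shows "(\<alpha> - 1) * (2 * l) powr (- \<alpha>) \<le> l powr (1 - \<alpha>) - (l + 1) powr (1 - \<alpha>)"
proof -
  have "\<exists>z>l. z < l + 1 \<and> (l + 1) powr (1 - \<alpha>) - l powr (1 - \<alpha>) =
      (l + 1 - l) * ((1 - \<alpha>) * z powr (1 - \<alpha> - 1))"
  proof (rule MVT2)
    fix x assume "l \<le> x" "x \<le> l + 1"
    then show "((\<lambda>x. x powr (1 - \<alpha>)) has_real_derivative (1 - \<alpha>) * x powr (1 - \<alpha> - 1)) (at x)"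
      using assms by (intro has_real_derivative_powr) auto
  qed simp
  then obtain z where z: "l < z" "z < l + 1"
    and eq: "(l + 1) powr (1 - \<alpha>) - l powr (1 - \<alpha>) = (l + 1 - l) * ((1 - \<alpha>) * z powr (1 - \<alpha> - 1))"
    by blast
  have "(2 * l) powr (- \<alpha>) \<le> z powr (- \<alpha>)"
    using assms z by (intro powr_mono2') auto
  then have "(\<alpha> - 1) * (2 * l) powr (- \<alpha>) \<le> (\<alpha> - 1) * z powr (- \<alpha>)"
    using assms by (intro mult_left_mono) auto
  also have "\<dots> = l powr (1 - \<alpha>) - (l + 1) powr (1 - \<alpha>)"
    using eq by (simp add: algebra_simps)
  finally show ?thesis .
qed

text \<open>The factors are \<open>exp 1\<close>, which forces a gain of \<open>1\<close> in
  \<open>L\<close>, the constant of \<open>step\<close>, and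
  \<open>2 powr \<alpha> / (\<alpha> - 1)\<close> from \<open>powr_diff_lower_bound\<close>.\<close>

definition growth_const :: "real \<Rightarrow> real \<Rightarrow> real" where
  "growth_const \<alpha> C = exp 1 * (2 * C * (2 * \<alpha>) powr \<alpha>) * 2 powr \<alpha> / (\<alpha> - 1)"

lemma growth_const_pos: "1 < \<alpha> \<Longrightarrow> 0 < C \<Longrightarrow> 0 < growth_const \<alpha> C"
  by (simp add: growth_const_def)

text \<open>What remains of the metric setting for a fixed center: \<open>m s\<close> is the measure
  of the ball of radius \<open>s\<close>, \<open>f\<close> is the superradius at \<open>r\<close>,
  and \<open>cutoff\<close> is the outcome of the Sobolev test.\<close>

locale cutoff_profile =
  fixes m \<Phi> :: "real \<Rightarrow> real" and r \<alpha> C f :: real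
  assumes \<alpha>: "1 < \<alpha>" and C: "0 < C" and f: "0 < f" and r: "0 < r"
    and pos: "\<And>s. 0 < s \<Longrightarrow> 0 < m s"
    and mono: "\<And>s t. 0 < s \<Longrightarrow> s \<le> t \<Longrightarrow> t \<le> r \<Longrightarrow> m s \<le> m t"
    and growth: "\<And>t. 1 < t \<Longrightarrow> t * (ln t) powr \<alpha> \<le> \<Phi> t"
    and cutoff: "\<And>p q \<kappa>. 0 < p \<Longrightarrow> p < q \<Longrightarrow> q \<le> r \<Longrightarrow>
      (\<And>k. 0 < k \<Longrightarrow> \<Phi> (1 / k) * m p \<le> m r \<Longrightarrow> \<kappa> \<le> k) \<Longrightarrow>
      \<kappa> \<le> 2 * C * f / (q - p) * ((m q - m p) / m r)"
begin

definition "L s = ln (m r / m s)"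

lemma L_nonneg: "0 < s \<Longrightarrow> s \<le> r \<Longrightarrow> 0 \<le> L s"
  using mono[of s r] pos[of s] by (simp add: L_def)

lemma L_antimono: "0 < s \<Longrightarrow> s \<le> t \<Longrightarrow> t \<le> r \<Longrightarrow> L t \<le> L s"
  using mono[of s t] pos[of s] pos[of t] pos[OF r] by (auto simp: L_def intro!: divide_left_mono)

text \<open>The cutoff estimate with \<open>\<kappa>\<close> from the inverted growth condition,
  after \<open>m q - m p\<close> is enlarged to \<open>m q\<close>.\<close>

lemma step:
  assumes "0 < p" "p < q" "q \<le> r"
  shows "m p * L p powr \<alpha> \<le> 2 * C * (2 * \<alpha>) powr \<alpha> * f / (q - p) * m q"
proof (cases "m p = m r")
  \<comment> \<open>Here \<open>L p = 0\<close>, so the left side vanishes; the inversion in the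
    other case requires \<open>1 < s\<close>.\<close>
  case True
  then show ?thesis
    using pos[of p] pos[of q] assms C f by (simp add: L_def)
next
  case False
  define s where "s = m r / m p"
  have mp: "0 < m p" "0 < m r" "m p \<le> m r"
    using pos[of p] pos[OF r] mono[of p r] assms by auto
  have s: "1 < s" using False mp by (simp add: s_def)
  \<comment> \<open>The lower bound for \<open>k\<close> that
    \<open>superlinear_inverse_bound\<close> gives at \<open>t = 1 / k\<close>, as
    \<open>ln s = L p\<close>.\<close>
  define \<kappa> where "\<kappa> = L p powr \<alpha> / ((2 * \<alpha>) powr \<alpha> * s)"
  have M: "0 < (2 * \<alpha>) powr \<alpha>" using \<alpha> by simp
  have "\<kappa> \<le> 2 * C * f / (q - p) * ((m q - m p) / m r)"
  proof (rule cutoff[OF assms])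
    fix k :: real assume k: "0 < k" "\<Phi> (1 / k) * m p \<le> m r"
    then have "\<Phi> (1 / k) \<le> s" using mp by (simp add: s_def field_simps)
    then have "1 / k * (ln s) powr \<alpha> \<le> (2 * \<alpha>) powr \<alpha> * s"
      using superlinear_inverse_bound[of \<alpha> s \<Phi> "1 / k"] \<alpha> s growth by simp
    then have "L p powr \<alpha> \<le> k * ((2 * \<alpha>) powr \<alpha> * s)"
      using k by (simp add: field_simps L_def s_def)
    then show "\<kappa> \<le> k" using M s by (simp add: \<kappa>_def divide_le_eq)
  qed
  also have "\<dots> \<le> 2 * C * f / (q - p) * (m q / m r)"
    using assms C f mp by (intro mult_left_mono divide_right_mono) auto
  finally have "\<kappa> * ((2 * \<alpha>) powr \<alpha> * m r) \<le> 2 * C * f / (q - p) * (m q / m r) * ((2 * \<alpha>) powr \<alpha> * m r)"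
    using M mp by (intro mult_right_mono) auto
  moreover have "\<kappa> * ((2 * \<alpha>) powr \<alpha> * m r) = m p * L p powr \<alpha>"
    using M mp by (simp add: \<kappa>_def s_def)
  ultimately show ?thesis using mp by (simp add: mult_ac)
qed

abbreviation "K \<equiv> growth_const \<alpha> C"

lemma K_pos: "0 < K" using \<alpha> C by (rule growth_const_pos)

text \<open>
  If the bound failed, then \<open>L\<close> would grow by at least \<open>1\<close> between consecutive radii of a sequence
  that decreases from at most \<open>r/2\<close> to \<open>r/4\<close>, so \<open>m (r/4)\<close> would be \<open>0\<close>.
\<close>

lemma large_ratio:
  assumes L1: "1 \<le> L (r / 2)"
  shows "L (r / 2) powr (\<alpha> - 1) \<le> 4 * K * f / r"
proof (rule ccontr)
  define l where "l n = L (r / 2) + real n" for n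
  \<comment> \<open>At radius \<open>\<rho> n\<close> the function \<open>L\<close> will have
    reached \<open>l n\<close>; the second summand is the room left for all later
    decrements.\<close>
  define \<rho> where "\<rho> n = r / 4 + K * f * l n powr (1 - \<alpha>)" for n
  define A where "A = 2 * C * (2 * \<alpha>) powr \<alpha>"
  have A: "0 < A" using \<alpha> C by (simp add: A_def)
  have l: "1 \<le> l n" "L (r / 2) \<le> l n" for n using L1 by (auto simp: l_def)
  assume "\<not> ?thesis"
  then have "4 * K * f / r < L (r / 2) powr (\<alpha> - 1)" by simp
  then have "4 * K * f * L (r / 2) powr (1 - \<alpha>) < L (r / 2) powr (\<alpha> - 1) * L (r / 2) powr (1 - \<alpha>) * r"
    using r L1 by (simp add: field_simps)
  also have "\<dots> = r" using L1 by (simp flip: powr_add)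
  \<comment> \<open>This says \<open>\<rho> 0 \<le> r / 2\<close>.\<close>
  finally have start: "K * f * L (r / 2) powr (1 - \<alpha>) \<le> r / 4" by simp
  have \<rho>: "r / 4 \<le> \<rho> n" "\<rho> n \<le> r / 2" for n
  proof -
    have "l n powr (1 - \<alpha>) \<le> L (r / 2) powr (1 - \<alpha>)"
      using l[of n] L1 \<alpha> by (intro powr_mono2') auto
    then have "K * f * l n powr (1 - \<alpha>) \<le> K * f * L (r / 2) powr (1 - \<alpha>)"
      using K_pos f by (intro mult_left_mono) auto
    then show "\<rho> n \<le> r / 2" using start by (simp add: \<rho>_def)
    show "r / 4 \<le> \<rho> n" using K_pos f by (simp add: \<rho>_def)
  qed
  have grow: "l n \<le> L (\<rho> n)" for n
  proof (induction n)
    case 0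
    then show ?case using L_antimono[of "\<rho> 0" "r / 2"] \<rho>[of 0] r by (simp add: l_def)
  next
    case (Suc n)
    let ?p = "\<rho> (Suc n)" and ?q = "\<rho> n"
    \<comment> \<open>\<open>K\<close> is chosen to make this an equality; for a gap of this size
      \<open>step\<close> yields a factor \<open>exp 1\<close> in \<open>m\<close>, that is, a gain
      of \<open>1\<close> in \<open>L\<close>.\<close>
    have "exp 1 * A * f / l n powr \<alpha> = K * f * ((\<alpha> - 1) * (2 * l n) powr (- \<alpha>))"
      using \<alpha> l[of n] by (simp add: growth_const_def A_def powr_mult powr_minus field_simps)
    also have "\<dots> \<le> K * f * (l n powr (1 - \<alpha>) - (l n + 1) powr (1 - \<alpha>))"
      using powr_diff_lower_bound[OF \<alpha> l(1)] K_pos f by (intro mult_left_mono) auto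
    also have "\<dots> = ?q - ?p" by (simp add: \<rho>_def l_def algebra_simps)
    finally have gap: "exp 1 * A * f / l n powr \<alpha> \<le> ?q - ?p" .
    have ln: "0 < l n powr \<alpha>" using l[of n] by simp
    then have "0 < exp 1 * A * f / l n powr \<alpha>" using A f by simp
    then have less: "?p < ?q" using gap by linarith
    have bds: "0 < ?p" "?q \<le> r" using \<rho>[of n] \<rho>[of "Suc n"] r by auto
    have mpq: "0 < m ?p" "0 < m ?q" using bds less pos by auto
    have "l n \<le> L ?p" using Suc.IH L_antimono[of ?p ?q] bds less by simp
    then have "m ?p * l n powr \<alpha> \<le> m ?p * L ?p powr \<alpha>"
      using mpq \<alpha> l[of n] by (intro mult_left_mono powr_mono2) auto
    also have "\<dots> \<le> A * f / (?q - ?p) * m ?q"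
      using step[OF bds(1) less bds(2)] by (simp add: A_def)
    also have "\<dots> \<le> A * f / (exp 1 * A * f / l n powr \<alpha>) * m ?q"
      using gap less mpq A f ln by (intro mult_right_mono divide_left_mono) auto
    also have "\<dots> = m ?q / exp 1 * l n powr \<alpha>" using A f ln by (simp add: field_simps)
    finally have "m ?p \<le> m ?q / exp 1" by (rule mult_right_le_imp_le) (rule ln)
    then have "exp 1 * (m r / m ?q) \<le> m r / m ?p"
      using mpq pos[OF r] by (simp add: field_simps)
    then have "ln (exp 1 * (m r / m ?q)) \<le> L ?p"
      unfolding L_def using mpq pos[OF r] by (subst ln_le_cancel_iff) auto
    also have "ln (exp 1 * (m r / m ?q)) = 1 + L ?q"
      using mpq pos[OF r] by (subst ln_mult) (auto simp: L_def)
    finally show ?case using Suc.IH by (simp add: l_def)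
  qed
  \<comment> \<open>All radii stay at or above \<open>r / 4\<close>, so \<open>L (r / 4)\<close>
    would bound the unbounded sequence \<open>l\<close>.\<close>
  obtain n where "L (r / 4) < real n" using reals_Archimedean2 by blast
  moreover have "L (\<rho> n) \<le> L (r / 4)" using \<rho>[of n] r by (intro L_antimono) auto
  ultimately show False using grow[of n] L1 by (simp add: l_def)
qed

text \<open>Now the annulus term is kept: for \<open>p = r / 2\<close> and \<open>q = r\<close> its
  share of \<open>m r\<close> is \<open>1 - exp (- L (r / 2))\<close>, which is at most
  \<open>L (r / 2)\<close>.\<close>

lemma small_ratio:
  assumes L1: "L (r / 2) \<le> 1"
  shows "1 \<le> 4 * exp 1 * C * f / r * L (r / 2)"
proof -
  define s where "s = m r / m (r / 2)"
  have mp: "0 < m (r / 2)" "0 < m r" using pos r by auto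
  have "exp (L (r / 2)) = s" using mp by (simp add: L_def s_def)
  then have "s \<le> exp 1" using L1 by auto
  have "1 / exp 1 \<le> 2 * C * f / (r - r / 2) * ((m r - m (r / 2)) / m r)"
  proof (rule cutoff)
    fix k :: real assume k: "0 < k" "\<Phi> (1 / k) * m (r / 2) \<le> m r"
    then have le: "\<Phi> (1 / k) \<le> s" using mp by (simp add: s_def field_simps)
    \<comment> \<open>Otherwise \<open>ln (1 / k)\<close> is at least \<open>1\<close>, and the
      growth condition gives \<open>\<Phi> (1 / k) \<ge> 1 / k > exp 1 \<ge> s\<close>.\<close>
    have "1 / k \<le> exp 1"
    proof (rule ccontr)
      assume "\<not> 1 / k \<le> exp 1"
      then have gt: "exp 1 < 1 / k" by simp
      then have one: "1 < 1 / k" using exp_ge_add_one_self[of "1::real"] by linarith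
      have "1 \<le> ln (1 / k)" using gt k ln_mono[of "exp 1" "1 / k"] by (simp del: ln_div)
      then have "1 / k * 1 \<le> 1 / k * ln (1 / k) powr \<alpha>"
        using \<alpha> k by (intro mult_left_mono ge_one_powr_ge_zero) auto
      also have "\<dots> \<le> s" using growth[OF one] le by simp
      finally show False using gt \<open>s \<le> exp 1\<close> by simp
    qed
    then show "1 / exp 1 \<le> k" using k by (simp add: field_simps)
  qed (use r in auto)
  also have "(m r - m (r / 2)) / m r = 1 - 1 / s" using mp by (simp add: s_def field_simps)
  also have "1 / s = exp (- L (r / 2))" using mp by (simp add: L_def s_def exp_minus)
  also have "2 * C * f / (r - r / 2) * (1 - exp (- L (r / 2))) \<le> 2 * C * f / (r - r / 2) * L (r / 2)"
    using exp_ge_add_one_self[of "- L (r / 2)"] r C f by (intro mult_left_mono) auto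
  finally show ?thesis using r by (simp add: field_simps)
qed

end

section \<open>Superradius and doubling bounds, and the passage to metric balls\<close>

context cutoff_profile
begin

text \<open>The entries \<open>1 / (4 * K)\<close> and \<open>1 / (4 * exp 1 * C)\<close> of the
  minimum serve large \<open>L (r / 2)\<close>, and small \<open>L (r / 2)\<close> with negative
  \<open>\<beta>\<close>; in the remaining cases \<open>1 \<le> f / r\<close> suffices.\<close>

lemma superradius_bound:
  assumes "-1 \<le> \<beta>" "\<beta> \<le> \<alpha> - 1" "r \<le> f"
  shows "min 1 (min (1 / (4 * K)) (1 / (4 * exp 1 * C))) * L (r / 2) powr \<beta> \<le> f / r"
    (is "?c * _ \<le> _")
proof -
  have c: "0 \<le> ?c" "?c \<le> 1" "?c \<le> 1 / (4 * K)" "?c \<le> 1 / (4 * exp 1 * C)"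
    using K_pos C by auto
  have fr: "1 \<le> f / r" using assms r by simp
  have bound: "?c * x \<le> f / r" if "?c \<le> 1 / a" "0 \<le> x" "x \<le> a * (f / r)" "0 < a" for a x
  proof -
    have "?c * x \<le> 1 / a * (a * (f / r))"
      using c that by (intro mult_mono) auto
    then show ?thesis using that by simp
  qed
  consider "1 \<le> L (r / 2)" | "L (r / 2) = 0" | "0 < L (r / 2)" "L (r / 2) < 1"
    using L_nonneg[of "r / 2"] r by fastforce
  then show ?thesis
  proof cases
    case 1
    have "L (r / 2) powr \<beta> \<le> L (r / 2) powr (\<alpha> - 1)" using 1 assms by (intro powr_mono) auto
    also have "\<dots> \<le> 4 * K * (f / r)" using large_ratio[OF 1] by simp
    finally show ?thesis using K_pos by (intro bound[of "4 * K"] c(3)) auto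
  next
    \<comment> \<open>By convention \<open>0 powr \<beta> = 0\<close>, also for negative
      \<open>\<beta>\<close>.\<close>
    case 2
    then show ?thesis using fr by simp
  next
    case 3
    show ?thesis
    proof (cases "0 \<le> \<beta>")
      case True
      then have "L (r / 2) powr \<beta> \<le> 1 powr \<beta>" using 3 by (intro powr_mono2) auto
      then show ?thesis using bound[of 1 "L (r / 2) powr \<beta>"] c fr by simp
    next
      case False
      \<comment> \<open>The base is below \<open>1\<close> and \<open>-1 \<le> \<beta>\<close>, so
        the worst case is the reciprocal, which \<open>small_ratio\<close> controls.\<close>
      have "L (r / 2) powr \<beta> \<le> L (r / 2) powr (- 1)"
        using 3 assms by (intro powr_mono') auto
      also have "\<dots> = 1 / L (r / 2)" using 3 by (simp add: powr_minus_divide)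
      also have "\<dots> \<le> 4 * exp 1 * C * (f / r)"
        using small_ratio 3 by (simp add: divide_le_eq mult_ac)
      finally show ?thesis using C by (intro bound[of "4 * exp 1 * C"] c(4)) auto
    qed
  qed
qed

text \<open>For \<open>f = r\<close>, \<open>large_ratio\<close> bounds a positive power of
  \<open>L (r / 2)\<close> by \<open>4 * K\<close>; the maximum with \<open>1\<close> covers
  \<open>L (r / 2) < 1\<close>.\<close>

lemma ratio_bound:
  assumes "f = r"
  shows "m r \<le> exp (max 1 ((4 * K) powr (1 / (\<alpha> - 1)))) * m (r / 2)"
proof -
  have mp: "0 < m (r / 2)" "0 < m r" using pos r by auto
  have "L (r / 2) \<le> max 1 ((4 * K) powr (1 / (\<alpha> - 1)))"
  proof (cases "1 \<le> L (r / 2)")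
    case True
    then have "L (r / 2) powr (\<alpha> - 1) \<le> 4 * K" using large_ratio assms r by simp
    then have "(L (r / 2) powr (\<alpha> - 1)) powr (1 / (\<alpha> - 1)) \<le> (4 * K) powr (1 / (\<alpha> - 1))"
      using \<alpha> by (intro powr_mono2) auto
    then show ?thesis using \<alpha> True by (simp add: powr_powr)
  qed simp
  then have "exp (L (r / 2)) \<le> exp (max 1 ((4 * K) powr (1 / (\<alpha> - 1))))" by simp
  then show ?thesis using mp by (simp add: L_def pos_divide_le_eq del: exp_le_cancel_iff)
qed

end

lemma (in Metric_space) cutoff_profile_measure:
  assumes sets: "sets \<mu> = sets metric_borel"
    and balls: "\<And>s. 0 < s \<Longrightarrow> 0 < emeasure \<mu> (mball y s) \<and> emeasure \<mu> (mball y s) < \<infinity>"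
    and y: "y \<in> M" and r: "0 < r" "r \<le> \<phi> r"
    and young: "young_function \<Phi>"
    and sobolev: "weak_orlicz_sobolev \<mu> \<Phi> \<phi> C" and C: "0 < C"
    and growth: "\<And>t. 1 < t \<Longrightarrow> t * (ln t) powr \<alpha> \<le> \<Phi> t" and \<alpha>: "1 < \<alpha>"
  shows "cutoff_profile (\<lambda>s. measure \<mu> (mball y s)) \<Phi> r \<alpha> C (\<phi> r)"
proof
  show "0 < measure \<mu> (mball y s)" if "0 < s" for s
    using balls[OF that] by (simp add: measure_def enn2real_positive_iff)
  show "measure \<mu> (mball y s) \<le> measure \<mu> (mball y t)" if "0 < s" "s \<le> t" "t \<le> r" for s t
  proof (rule measure_mono_fmeasurable)
    have "mball y u \<in> sets \<mu>" for u
      using openin_subset unfolding sets metric_borel_def by (subst sets_measure_of) fastforce+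
    then show "mball y s \<in> sets \<mu>" "mball y t \<in> fmeasurable \<mu>"
      using balls[of t] that by (auto simp: fmeasurable_def)
  qed (use that in auto)
  show "\<kappa> \<le> 2 * C * \<phi> r / (q - p) * ((measure \<mu> (mball y q) - measure \<mu> (mball y p)) / measure \<mu> (mball y r))"
    if "0 < p" "p < q" "q \<le> r"
      "\<And>k. 0 < k \<Longrightarrow> \<Phi> (1 / k) * measure \<mu> (mball y p) \<le> measure \<mu> (mball y r) \<Longrightarrow> \<kappa> \<le> k" for p q \<kappa>
    using that balls[OF r(1)] young r C
    by (intro weak_orlicz_sobolev_cutoff[OF sets y _ _ _ _ _ _ sobolev]) (auto simp: young_function_def)
qed (use assms in auto)

theorem theorem4p2:
  fixes \<alpha> C\<^sub>S :: real
  assumes "\<alpha> > 1" and "C\<^sub>S > 0"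
  shows "\<exists>C :: real \<Rightarrow> real. (\<forall>\<epsilon>>0. C \<epsilon> > 0) \<and>
    (\<forall>(X :: 'a set) d \<mu> \<Phi> \<phi>.
       Metric_space X d \<and>
       sets \<mu> = sets (Metric_space.metric_borel X d) \<and>
       (\<forall>y\<in>X. \<forall>r>0. 0 < emeasure \<mu> (Metric_space.mball X d y r) \<and>
                      emeasure \<mu> (Metric_space.mball X d y r) < \<infinity>) \<and>
       young_function \<Phi> \<and>
       mono_on {0<..} \<phi> \<and> (\<forall>r>0. \<phi> r \<ge> r) \<and>
       Metric_space.weak_orlicz_sobolev X d \<mu> \<Phi> \<phi> C\<^sub>S \<and>
       (\<forall>t>1. \<Phi> t \<ge> t * (ln t) powr \<alpha>)
       \<longrightarrow>
       (\<forall>\<epsilon>. 0 < \<epsilon> \<and> \<epsilon> \<le> \<alpha> \<longrightarrow>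
          (\<forall>y\<in>X. \<forall>r>0.
             \<phi> r / r \<ge> C \<epsilon> * (ln (measure \<mu> (Metric_space.mball X d y r) /
                                   measure \<mu> (Metric_space.mball X d y (r / 2))))
                               powr (\<alpha> - 1 - \<epsilon>))) \<and>
       ((\<forall>r>0. \<phi> r = r) \<longrightarrow> Metric_space.doubling X d \<mu>))"
proof -
  \<comment> \<open>The minimum in \<open>superradius_bound\<close> is the same for all exponents in
    its range, so one constant serves every \<open>\<epsilon>\<close>.\<close>
  define c where "c = min 1 (min (1 / (4 * growth_const \<alpha> C\<^sub>S)) (1 / (4 * exp 1 * C\<^sub>S)))"
  have c: "0 < c" using growth_const_pos[OF assms] assms by (simp add: c_def)
  show ?thesis
  proof (rule exI[of _ "\<lambda>_. c"], intro conjI allI impI ballI; (elim conjE)?)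
    fix X :: "'a set" and d \<mu> \<Phi> \<phi>
    assume X: "Metric_space X d" and sets: "sets \<mu> = sets (Metric_space.metric_borel X d)"
      and balls: "\<forall>y\<in>X. \<forall>r>0. 0 < emeasure \<mu> (Metric_space.mball X d y r) \<and>
                      emeasure \<mu> (Metric_space.mball X d y r) < \<infinity>"
      and young: "young_function \<Phi>" and \<phi>: "\<forall>r>0. \<phi> r \<ge> r"
      and sobolev: "Metric_space.weak_orlicz_sobolev X d \<mu> \<Phi> \<phi> C\<^sub>S"
      and growth: "\<forall>t>1. \<Phi> t \<ge> t * (ln t) powr \<alpha>"
    interpret Metric_space X d by (fact X)
    have profile: "cutoff_profile (\<lambda>s. measure \<mu> (mball y s)) \<Phi> r \<alpha> C\<^sub>S (\<phi> r)"
      if "y \<in> X" "0 < r" for y r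
      using that assms balls \<phi> growth
      by (intro cutoff_profile_measure[OF sets _ _ _ _ young sobolev]) auto
    show "\<phi> r / r \<ge> c * (ln (measure \<mu> (mball y r) / measure \<mu> (mball y (r / 2)))) powr (\<alpha> - 1 - \<epsilon>)"
      if "0 < \<epsilon>" "\<epsilon> \<le> \<alpha>" "y \<in> X" "0 < r" for \<epsilon> y r
    proof -
      interpret cutoff_profile "\<lambda>s. measure \<mu> (mball y s)" \<Phi> r \<alpha> C\<^sub>S "\<phi> r"
        using that by (intro profile)
      show ?thesis
        using superradius_bound[of "\<alpha> - 1 - \<epsilon>"] that \<phi> by (simp add: c_def L_def)
    qed
    show "doubling \<mu>" if \<phi>_id: "\<forall>r>0. \<phi> r = r"
      unfolding doubling_def
    proof (intro exI conjI ballI allI impI)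
      let ?C = "exp (max 1 ((4 * growth_const \<alpha> C\<^sub>S) powr (1 / (\<alpha> - 1))))"
      show "1 \<le> ?C" by simp
      fix y and r :: real assume "y \<in> X" "0 < r"
      \<comment> \<open>The profile is taken at radius \<open>2 * r\<close>, whose half is
        \<open>r\<close>.\<close>
      then interpret cutoff_profile "\<lambda>s. measure \<mu> (mball y s)" \<Phi> "2 * r" \<alpha> C\<^sub>S "\<phi> (2 * r)"
        by (intro profile) auto
      show "measure \<mu> (mball y (2 * r)) \<le> ?C * measure \<mu> (mball y r)"
        using ratio_bound \<phi>_id \<open>0 < r\<close> by simp
    qed
  qed (use c in simp)
qed

end
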